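(* Let $\varphi:\mathbb{X}\to\mathbb{R}$ be bounded and measurable, and suppose there exist constants $C<\infty$ and $\rho\in[0,1)$ such that $d_{\mathrm{tv}}(P_s^k(x,\cdot),\pi)\le C\rho^k$ for all $x\in\mathbb{X}$, $s\in\mathbb{S}$, $k\ge0$. Let $g_s(x)=\sum_{k=0}^\infty P_s^k\bar\varphi(x)$, where $\bar\varphi=\varphi-\pi(\varphi)$, and set $$M_n=\sum_{k=1}^n\big[g_{S_{k-1}}(X_k)-P_{S_{k-1}}g_{S_{k-1}}(X_{k-1})\big],\qquad R_n=\sum_{k=1}^n\big[P_{S_{k-1}}g_{S_{k-1}}(X_{k-1})-P_{S_k}g_{S_k}(X_k)\big].$$ Then, almost surely as $n\to\infty$, $$\frac{R_n}{n}\to0,\qquad\frac{R_n}{\sqrt n}\to0\qquad\text{and}\qquad\frac{M_n}{n}\to0.$$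
   Context: $(\mathbb{X},\mathcal{X})$ and $(\mathbb{S},\mathcal{S})$ are measurable spaces. $\pi$ is a probability measure on $\mathbb{X}$ and $\{P_s\}_{s\in\mathbb{S}}$ is a family of Markov transition probabilities on $\mathbb{X}$, each $\pi$-invariant, such that $(s,x)\mapsto P_s(x,A)$ is $\mathcal{S}\otimes\mathcal{X}$-measurable for all $A\in\mathcal{X}$. $(S_k,X_k)_{k\ge0}$ is an $\mathbb{S}\times\mathbb{X}$-valued stochastic process adapted to a filtration $(\mathcal{F}_k)_{k\ge0}$ such that for all $k\ge0$ and $A\in\mathcal{X}$, $\mathbb{P}(X_{k+1}\in A\mid\mathcal{F}_k)=P_{S_k}(X_k,A)$ a.s. Notation: $\pi(f)=\int f\,d\pi$, $(Pf)(x)=\int P(x,dy)f(y)$, $P^0$ is the identity, $\rho^0=1$; $d_{\mathrm{tv}}(\mu,\nu)=\sup_A|\mu(A)-\nu(A)|$. Under the stated ergodicity hypothesis the series defining $g_s$ converges and $(s,x)\mapsto g_s(x)$ is bounded and measurable. *)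

theory Defs
  imports "HOL-Probability.Probability"
begin

text \<open>The measure \<open>XX\<close> stands for a measurable space: only its space and its sets are
  used. A Markov transition probability on it is a measurable map from \<open>XX\<close> to
  \<open>prob_algebra XX\<close>.\<close>

text \<open>The supremum is over a nonempty set bounded by 1 when both measures are probability
  measures with the same measurable sets, the only case in which the definition is meant to be used.\<close>

definition dtv :: "'x measure \<Rightarrow> 'x measure \<Rightarrow> real" where
  "dtv \<mu> \<nu> = (SUP A\<in>sets \<mu>. \<bar>measure \<mu> A - measure \<nu> A\<bar>)"

text \<open>Kernel iterates: \<open>P\<^sup>k\<^sup>+\<^sup>1(x,A) = \<integral> P\<^sup>k(x,dy) P(y,A)\<close>, with \<open>P\<^sup>0(x,\<cdot>)\<close> the point mass at \<open>x\<close>.\<close>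

primrec kernel_pow :: "'x measure \<Rightarrow> ('x \<Rightarrow> 'x measure) \<Rightarrow> nat \<Rightarrow> 'x \<Rightarrow> 'x measure" where
  "kernel_pow XX K 0 x = return XX x"
| "kernel_pow XX K (Suc k) x = kernel_pow XX K k x \<bind> K"

definition kernel_app :: "('x \<Rightarrow> 'x measure) \<Rightarrow> ('x \<Rightarrow> real) \<Rightarrow> 'x \<Rightarrow> real" where
  "kernel_app K f x = (\<integral>y. f y \<partial>K x)"

definition poisson_sol ::
  "'x measure \<Rightarrow> 'x measure \<Rightarrow> ('x \<Rightarrow> 'x measure) \<Rightarrow> ('x \<Rightarrow> real) \<Rightarrow> 'x \<Rightarrow> real" where
  "poisson_sol XX \<pi> K \<phi> x =
     (\<Sum>k. kernel_app (kernel_pow XX K k) (\<lambda>y. \<phi> y - (\<integral>z. \<phi> z \<partial>\<pi>)) x)"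

definition M_part ::
  "('s \<Rightarrow> 'x \<Rightarrow> 'x measure) \<Rightarrow> ('s \<Rightarrow> 'x \<Rightarrow> real) \<Rightarrow> (nat \<Rightarrow> 'w \<Rightarrow> 's) \<Rightarrow> (nat \<Rightarrow> 'w \<Rightarrow> 'x)
     \<Rightarrow> nat \<Rightarrow> 'w \<Rightarrow> real" where
  "M_part P g S X n \<omega> =
     (\<Sum>k=1..n. g (S (k - 1) \<omega>) (X k \<omega>)
              - kernel_app (P (S (k - 1) \<omega>)) (g (S (k - 1) \<omega>)) (X (k - 1) \<omega>))"

definition R_part ::
  "('s \<Rightarrow> 'x \<Rightarrow> 'x measure) \<Rightarrow> ('s \<Rightarrow> 'x \<Rightarrow> real) \<Rightarrow> (nat \<Rightarrow> 'w \<Rightarrow> 's) \<Rightarrow> (nat \<Rightarrow> 'w \<Rightarrow> 'x)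
     \<Rightarrow> nat \<Rightarrow> 'w \<Rightarrow> real" where
  "R_part P g S X n \<omega> =
     (\<Sum>k=1..n. kernel_app (P (S (k - 1) \<omega>)) (g (S (k - 1) \<omega>)) (X (k - 1) \<omega>)
              - kernel_app (P (S k \<omega>)) (g (S k \<omega>)) (X k \<omega>))"

end

theory Submission
  imports Defs "HOL-Library.Discrete_Functions"
begin

text \<open>Since \<open>\<phi> - \<pi>(\<phi>)\<close> has \<open>\<pi>\<close>-mean zero, its integral against \<open>P\<^sub>s\<^sup>k(x,\<cdot>)\<close> is bounded by a constant
  times \<open>d\<^sub>t\<^sub>v(P\<^sub>s\<^sup>k(x,\<cdot>), \<pi>) \<le> C \<rho>\<^sup>k\<close>, so \<open>g\<close> is bounded uniformly in \<open>s\<close> and \<open>x\<close>. The sum \<open>R\<^sub>n\<close> telescopes,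
  hence is bounded. The summands of \<open>M\<^sub>n\<close> are bounded martingale differences, hence orthogonal in \<open>L\<^sup>2\<close>,
  so \<open>E M\<^sub>n\<^sup>2 = O(n)\<close>. Therefore \<open>\<Sum>\<^sub>m E (M\<^bsub>m\<^sup>2\<^esub> / m\<^sup>2)\<^sup>2 < \<infinity>\<close>, which gives convergence along the squares, and
  boundedness of the increments fills the gaps between consecutive squares.\<close>

section \<open>Total variation distance and integrals of bounded functions\<close>

text \<open>The real-valued \<open>SUP\<close> in \<open>dtv\<close> dominates its members only when
  the set is bounded above; here probabilities lie in the unit interval, so 1 is an upper
  bound.\<close>

lemma abs_measure_diff_le_dtv:
  assumes "prob_space \<mu>" "prob_space \<nu>" "A \<in> sets \<mu>"
  shows "\<bar>measure \<mu> A - measure \<nu> A\<bar> \<le> dtv \<mu> \<nu>"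
  unfolding dtv_def
proof (rule cSUP_upper[OF assms(3)])
  show "bdd_above ((\<lambda>A. \<bar>measure \<mu> A - measure \<nu> A\<bar>) ` sets \<mu>)"
  proof (rule bdd_aboveI2)
    fix A
    show "\<bar>measure \<mu> A - measure \<nu> A\<bar> \<le> 1"
      using prob_space.prob_le_1[OF assms(1), of A] prob_space.prob_le_1[OF assms(2), of A]
        measure_nonneg[of \<mu> A] measure_nonneg[of \<nu> A]
      by linarith
  qed
qed

text \<open>The sum of the indicators of the layers \<open>i \<le> n f\<close> is \<open>\<lfloor>n f\<rfloor>\<close>; this reduces integrals to
  measures of sets.\<close>

lemma (in prob_space) integral_layer_sum:
  fixes f :: "'a \<Rightarrow> real" and n :: nat
  assumes [measurable]: "f \<in> borel_measurable M"
    and f: "\<And>x. x \<in> space M \<Longrightarrow> 0 \<le> f x \<and> f x \<le> 1"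
    and n: "n > 0"
  shows "\<bar>(\<integral>x. f x \<partial>M) - (\<Sum>i=1..n. measure M {x \<in> space M. real i \<le> real n * f x}) / real n\<bar>
    \<le> 1 / real n"
proof -
  define A where "A i = {x \<in> space M. real i \<le> real n * f x}" for i
  have [measurable]: "A i \<in> sets M" for i
    unfolding A_def by measurable
  have layers: "(\<Sum>i=1..n. indicator (A i) x) = real (nat \<lfloor>real n * f x\<rfloor>)" if x: "x \<in> space M" for x
  proof -
    have "real n * f x \<le> real n"
      using f[OF x] by (simp add: mult_left_le)
    \<comment> \<open>Because \<open>real n * f x\<close> is at most \<open>n\<close>, stopping the
      layers at \<open>n\<close> cuts off none of those that contain \<open>x\<close>.\<close>
    then have "{i \<in> {1..n}. x \<in> A i} = {1..nat \<lfloor>real n * f x\<rfloor>}"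
      using f[OF x] x unfolding A_def by (auto simp: le_nat_iff le_floor_iff)
    moreover have "(\<Sum>i=1..n. indicator (A i) x) = real (card {i \<in> {1..n}. x \<in> A i})"
      by (simp add: indicator_def sum.If_cases Int_def)
    ultimately show ?thesis by simp
  qed
  have int_f: "integrable M f"
    by (rule integrable_const_bound[of _ 1]) (use f in auto)
  have int_A: "integrable M (\<lambda>x. (\<Sum>i=1..n. indicator (A i) x) / real n)"
    by (intro integrable_divide_zero Bochner_Integration.integrable_sum) (simp add: emeasure_eq_measure)
  have "(\<Sum>i=1..n. measure M (A i)) / real n = (\<integral>x. (\<Sum>i=1..n. indicator (A i) x) / real n \<partial>M)"
    by (simp add: Bochner_Integration.integral_sum emeasure_eq_measure)
  then have "(\<integral>x. f x \<partial>M) - (\<Sum>i=1..n. measure M (A i)) / real n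
      = (\<integral>x. f x - (\<Sum>i=1..n. indicator (A i) x) / real n \<partial>M)"
    using int_f int_A by (simp del: integral_divide_zero)
  also have "\<bar>\<dots>\<bar> \<le> (\<integral>x. \<bar>f x - (\<Sum>i=1..n. indicator (A i) x) / real n\<bar> \<partial>M)"
    by (rule integral_abs_bound)
  also have "\<dots> \<le> 1 / real n"
  proof (rule integral_le_const)
    show "integrable M (\<lambda>x. \<bar>f x - (\<Sum>i=1..n. indicator (A i) x) / real n\<bar>)"
      using int_f int_A by (intro integrable_abs Bochner_Integration.integrable_diff)
    have "\<bar>f x - real (nat \<lfloor>real n * f x\<rfloor>) / real n\<bar> \<le> 1 / real n" if "x \<in> space M" for x
    proof -
      have "0 \<le> real n * f x" using f[OF that] by simp
      then have "\<bar>real n * f x - real (nat \<lfloor>real n * f x\<rfloor>)\<bar> \<le> 1" by linarith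
      then have "\<bar>real n * f x - real (nat \<lfloor>real n * f x\<rfloor>)\<bar> / real n \<le> 1 / real n"
        by (rule divide_right_mono) simp
      moreover have "\<bar>a - k / real n\<bar> = \<bar>real n * a - k\<bar> / real n" for a k :: real
        using n by (simp add: abs_if field_simps)
      ultimately show ?thesis by simp
    qed
    then show "AE x in M. \<bar>f x - (\<Sum>i=1..n. indicator (A i) x) / real n\<bar> \<le> 1 / real n"
      by (intro AE_I2) (simp only: layers)
  qed
  finally show ?thesis
    unfolding A_def .
qed

text \<open>Both integrals are approximated by averages over the same \<open>n\<close> layers. Each
  layer contributes a difference of at most \<open>dtv \<mu> \<nu>\<close>, and so does the average;
  the two approximation errors \<open>1 / real n\<close> vanish as \<open>n\<close> grows.\<close>

lemma integral_diff_le_dtv_unit: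
  fixes f :: "'a \<Rightarrow> real"
  assumes \<mu>: "prob_space \<mu>" and \<nu>: "prob_space \<nu>" and sets: "sets \<nu> = sets \<mu>"
    and f[measurable]: "f \<in> borel_measurable \<mu>"
    and f01: "\<And>x. x \<in> space \<mu> \<Longrightarrow> 0 \<le> f x \<and> f x \<le> 1"
  shows "\<bar>(\<integral>x. f x \<partial>\<mu>) - (\<integral>x. f x \<partial>\<nu>)\<bar> \<le> dtv \<mu> \<nu>"
proof -
  have space: "space \<nu> = space \<mu>" using sets by (rule sets_eq_imp_space_eq)
  have f'[measurable]: "f \<in> borel_measurable \<nu>" using f by (simp add: measurable_cong_sets[OF sets refl])
  have approx: "\<bar>(\<integral>x. f x \<partial>\<mu>) - (\<integral>x. f x \<partial>\<nu>)\<bar> \<le> dtv \<mu> \<nu> + 2 / real (Suc m)" for m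
  proof -
    define n where "n = Suc m"
    have "n > 0" by (simp add: n_def)
    define A where "A i = {x \<in> space \<mu>. real i \<le> real n * f x}" for i
    have A: "A i \<in> sets \<mu>" for i unfolding A_def by measurable
    have 1: "\<bar>(\<integral>x. f x \<partial>\<mu>) - (\<Sum>i=1..n. measure \<mu> (A i)) / real n\<bar> \<le> 1 / real n"
      using prob_space.integral_layer_sum[OF \<mu> f f01, of n] by (simp add: A_def n_def)
    have 2: "\<bar>(\<integral>x. f x \<partial>\<nu>) - (\<Sum>i=1..n. measure \<nu> (A i)) / real n\<bar> \<le> 1 / real n"
      using prob_space.integral_layer_sum[OF \<nu> f', of n] f01 by (simp add: A_def n_def space)
    have "\<bar>(\<Sum>i=1..n. measure \<mu> (A i)) - (\<Sum>i=1..n. measure \<nu> (A i))\<bar>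
        \<le> (\<Sum>i=1..n. \<bar>measure \<mu> (A i) - measure \<nu> (A i)\<bar>)"
      by (simp add: sum_subtractf[symmetric] sum_abs)
    also have "\<dots> \<le> (\<Sum>i=1..n. dtv \<mu> \<nu>)"
      by (intro sum_mono abs_measure_diff_le_dtv \<mu> \<nu> A)
    finally have "\<bar>(\<Sum>i=1..n. measure \<mu> (A i)) - (\<Sum>i=1..n. measure \<nu> (A i))\<bar> / real n
        \<le> real n * dtv \<mu> \<nu> / real n"
      by (intro divide_right_mono) auto
    then have 3: "\<bar>(\<Sum>i=1..n. measure \<mu> (A i)) / real n - (\<Sum>i=1..n. measure \<nu> (A i)) / real n\<bar>
        \<le> dtv \<mu> \<nu>"
      using \<open>n > 0\<close> by (simp add: diff_divide_distrib[symmetric] abs_divide)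
    have "2 / real n = 1 / real n + 1 / real n" by simp
    with 1 2 3 show ?thesis unfolding n_def[symmetric] by linarith
  qed
  have "(\<lambda>m. dtv \<mu> \<nu> + 2 * (1 / real (Suc m))) \<longlonglongrightarrow> dtv \<mu> \<nu> + 2 * 0"
    by (intro tendsto_intros LIMSEQ_Suc lim_1_over_n)
  then show ?thesis
    unfolding mult_zero_right add_0_right by (rule LIMSEQ_le_const) (use approx in auto)
qed

text \<open>The affine map \<open>(f x + B) / (2 * B)\<close> carries the range [-B, B] into [0, 1].
  The shift cancels in the difference because both measures have mass 1, and undoing the scaling
  produces the factor \<open>2 * B\<close>.\<close>

lemma integral_diff_le_dtv:
  fixes f :: "'a \<Rightarrow> real"
  assumes \<mu>: "prob_space \<mu>" and \<nu>: "prob_space \<nu>" and sets: "sets \<nu> = sets \<mu>"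
    and f[measurable]: "f \<in> borel_measurable \<mu>"
    and B: "B > 0" "\<And>x. x \<in> space \<mu> \<Longrightarrow> \<bar>f x\<bar> \<le> B"
  shows "\<bar>(\<integral>x. f x \<partial>\<mu>) - (\<integral>x. f x \<partial>\<nu>)\<bar> \<le> 2 * B * dtv \<mu> \<nu>"
proof -
  interpret \<mu>: prob_space \<mu> by fact
  interpret \<nu>: prob_space \<nu> by fact
  have space: "space \<nu> = space \<mu>" using sets by (rule sets_eq_imp_space_eq)
  have f'[measurable]: "f \<in> borel_measurable \<nu>" using f by (simp add: measurable_cong_sets[OF sets refl])
  have int: "integrable \<mu> f" "integrable \<nu> f"
    by (intro \<mu>.integrable_const_bound[of _ B] \<nu>.integrable_const_bound[of _ B] AE_I2;
        use B space in auto)+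
  have "\<bar>(\<integral>x. (f x + B) / (2 * B) \<partial>\<mu>) - (\<integral>x. (f x + B) / (2 * B) \<partial>\<nu>)\<bar> \<le> dtv \<mu> \<nu>"
  proof (rule integral_diff_le_dtv_unit[OF \<mu> \<nu> sets])
    fix x assume "x \<in> space \<mu>"
    then have "\<bar>f x\<bar> \<le> B" by (rule B)
    then show "0 \<le> (f x + B) / (2 * B) \<and> (f x + B) / (2 * B) \<le> 1"
      using B(1) by auto
  qed measurable
  moreover have "(\<integral>x. (f x + B) / (2 * B) \<partial>\<mu>) = ((\<integral>x. f x \<partial>\<mu>) + B) / (2 * B)"
    using int by (subst integral_divide_zero) (simp add: \<mu>.prob_space)
  moreover have "(\<integral>x. (f x + B) / (2 * B) \<partial>\<nu>) = ((\<integral>x. f x \<partial>\<nu>) + B) / (2 * B)"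
    using int by (subst integral_divide_zero) (simp add: \<nu>.prob_space)
  ultimately have "\<bar>((\<integral>x. f x \<partial>\<mu>) - (\<integral>x. f x \<partial>\<nu>)) / (2 * B)\<bar> \<le> dtv \<mu> \<nu>"
    by (simp only: diff_divide_distrib[symmetric]) simp
  then show ?thesis using B(1) by (simp add: abs_divide field_simps)
qed

section \<open>Kernels as conditional laws\<close>

text \<open>Pushing \<open>L x\<close> forward along \<open>Pair x\<close> replaces an integrand
  that varies with \<open>x\<close> by the fixed function \<open>case_prod f\<close> on the product,
  whose integral depends measurably on the measure.\<close>

lemma borel_measurable_integral_kernel:
  fixes f :: "'a \<Rightarrow> 'b \<Rightarrow> real"
  assumes f: "case_prod f \<in> borel_measurable (M \<Otimes>\<^sub>M N)"
    and L: "L \<in> M \<rightarrow>\<^sub>M subprob_algebra N"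
  shows "(\<lambda>x. \<integral>y. f x y \<partial>L x) \<in> borel_measurable M"
proof -
  have "(\<lambda>x. distr (L x) (M \<Otimes>\<^sub>M N) (Pair x)) \<in> M \<rightarrow>\<^sub>M subprob_algebra (M \<Otimes>\<^sub>M N)"
    by (rule measurable_distr2[OF _ L]) simp
  then have "(\<lambda>x. \<integral>z. case_prod f z \<partial>distr (L x) (M \<Otimes>\<^sub>M N) (Pair x)) \<in> borel_measurable M"
    by (rule measurable_compose[OF _ integral_measurable_subprob_algebra[OF f]])
  moreover have "(\<integral>z. case_prod f z \<partial>distr (L x) (M \<Otimes>\<^sub>M N) (Pair x)) = (\<integral>y. f x y \<partial>L x)"
    if "x \<in> space M" for x
  proof -
    have "sets (L x) = sets N" using sets_kernel[OF L that] .
    then have "Pair x \<in> L x \<rightarrow>\<^sub>M M \<Otimes>\<^sub>M N"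
      using measurable_Pair1'[OF that, of N] by (simp cong: measurable_cong_sets)
    then show ?thesis by (simp add: integral_distr[OF _ f])
  qed
  ultimately show ?thesis by (simp cong: measurable_cong)
qed

text \<open>The conditional law is given only through indicators of \<open>X\<close>. It determines
  the joint law of \<open>\<omega>\<close> and \<open>X \<omega>\<close> on
  \<open>F \<Otimes>\<^sub>M N\<close>, so \<open>X \<omega>\<close> can be integrated out against
  \<open>K \<omega>\<close> while the \<open>F\<close>-measurable argument of \<open>H\<close> stays
  frozen. This is needed for integrands such as
  \<open>g (S k \<omega>) (X (Suc k) \<omega>)\<close>.\<close>

lemma (in prob_space) integral_cond_kernel:
  fixes H :: "'a \<Rightarrow> 'b \<Rightarrow> real"
  assumes sub: "subalgebra M F"
    and X[measurable]: "X \<in> M \<rightarrow>\<^sub>M N"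
    and K: "K \<in> F \<rightarrow>\<^sub>M prob_algebra N"
    and cond: "\<And>A. A \<in> sets N \<Longrightarrow>
      AE \<omega> in M. real_cond_exp M F (\<lambda>\<omega>'. indicator A (X \<omega>')) \<omega> = measure (K \<omega>) A"
    and H: "case_prod H \<in> borel_measurable (F \<Otimes>\<^sub>M N)"
    and bound: "\<And>\<omega> y. \<omega> \<in> space M \<Longrightarrow> y \<in> space N \<Longrightarrow> \<bar>H \<omega> y\<bar> \<le> B"
  shows "(\<integral>\<omega>. H \<omega> (X \<omega>) \<partial>M) = (\<integral>\<omega>. (\<integral>y. H \<omega> y \<partial>K \<omega>) \<partial>M)"
proof -
  have space_F: "space F = space M" and sets_F: "sets F \<subseteq> sets M"
    using sub by (auto simp: subalgebra_def)
  have K_sub: "K \<in> F \<rightarrow>\<^sub>M subprob_algebra N" using K by (rule measurable_prob_algebraD)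
  have K_prob: "prob_space (K \<omega>)" "sets (K \<omega>) = sets N" "space (K \<omega>) = space N"
    if "\<omega> \<in> space M" for \<omega>
    using measurable_space[OF K, of \<omega>] that
    by (auto simp: space_prob_algebra space_F dest: sets_eq_imp_space_eq)
  interpret sigma_finite_subalgebra M F
    by (intro finite_measure_subalgebra_is_sigma_finite finite_measure_subalgebra.intro
        finite_measure_axioms finite_measure_subalgebra_axioms.intro sub)
  \<comment> \<open>The base measure of the mixture lives on the sigma-algebra for which
    \<open>K\<close> is a kernel. Integrals of \<open>F\<close>-measurable functions over
    \<open>R\<close> and over \<open>M\<close> agree, which allows the return to \<open>M\<close> at
    the end.\<close>
  define R where "R = restr_to_subalg M F"
  interpret R: prob_space R
    unfolding R_def by (rule prob_space_restr_to_subalg[OF sub prob_space_axioms])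
  have sets_R[measurable_cong]: "sets R = sets F"
    unfolding R_def by (rule sets_restr_to_subalg[OF sub])
  have space_R: "space R = space M" by (simp add: R_def space_restr_to_subalg)
  \<comment> \<open>\<open>J \<omega>\<close> is the law of the pair with first coordinate fixed at
    \<open>\<omega>\<close> and second coordinate drawn from \<open>K \<omega>\<close>.\<close>
  define J where "J = (\<lambda>\<omega>. distr (K \<omega>) (F \<Otimes>\<^sub>M N) (Pair \<omega>))"
  have J: "J \<in> R \<rightarrow>\<^sub>M subprob_algebra (F \<Otimes>\<^sub>M N)"
    unfolding J_def measurable_cong_sets[OF sets_R refl]
    by (rule measurable_distr2[OF _ K_sub]) simp
  have Pair_K: "Pair \<omega> \<in> K \<omega> \<rightarrow>\<^sub>M F \<Otimes>\<^sub>M N" if "\<omega> \<in> space M" for \<omega>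
    using measurable_Pair1'[of \<omega> F N] that K_prob(2)[OF that]
    by (simp add: space_F cong: measurable_cong_sets)
  \<comment> \<open>The first coordinate is the identity, measurable from \<open>M\<close> to the
    coarser \<open>F\<close>.\<close>
  have id[measurable]: "(\<lambda>\<omega>. (\<omega>, X \<omega>)) \<in> M \<rightarrow>\<^sub>M F \<Otimes>\<^sub>M N"
    by (rule measurable_Pair[OF measurable_from_subalg[OF sub measurable_ident_sets[OF refl]] X])
  \<comment> \<open>On rectangles both laws agree by the defining property of the conditional expectation.\<close>
  have law: "distr M (F \<Otimes>\<^sub>M N) (\<lambda>\<omega>. (\<omega>, X \<omega>)) = R \<bind> J" (is "?D = _")
  proof (rule measure_eqI_generator_eq[where \<Omega>="space F \<times> space N"
        and A="\<lambda>_. space F \<times> space N", OF Int_stable_pair_measure_generator[of F N]])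
    show "{a \<times> b |a b. a \<in> sets F \<and> b \<in> sets N} \<subseteq> Pow (space F \<times> space N)"
      by (auto dest: sets.sets_into_space)
    show "sets ?D = sigma_sets (space F \<times> space N) {a \<times> b |a b. a \<in> sets F \<and> b \<in> sets N}"
      by (simp add: sets_pair_measure)
    show "sets (R \<bind> J) = sigma_sets (space F \<times> space N) {a \<times> b |a b. a \<in> sets F \<and> b \<in> sets N}"
      by (subst sets_bind[OF sets_kernel[OF J]]) (auto simp: sets_pair_measure R.not_empty)
    show "range (\<lambda>_::nat. space F \<times> space N) \<subseteq> {a \<times> b |a b. a \<in> sets F \<and> b \<in> sets N}"
      by auto
    interpret D: prob_space ?D by (rule prob_space_distr[OF id])
    show "emeasure ?D (space F \<times> space N) \<noteq> \<infinity>"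
      using D.emeasure_finite by simp
    fix Z assume "Z \<in> {a \<times> b |a b. a \<in> sets F \<and> b \<in> sets N}"
    then obtain a b where Z: "Z = a \<times> b" and a: "a \<in> sets F" and b[measurable]: "b \<in> sets N" by auto
    have a_M[measurable]: "a \<in> sets M" using a sets_F by auto
    have b_int: "integrable M (\<lambda>\<omega>. indicator b (X \<omega>) :: real)"
      by (intro integrable_const_bound[of _ 1]) auto
    have K_b[measurable]: "(\<lambda>\<omega>. measure (K \<omega>) b) \<in> borel_measurable F"
      by (rule measurable_compose[OF K_sub measurable_measure_subprob_algebra[OF b]])
    have K_b_M[measurable]: "(\<lambda>\<omega>. measure (K \<omega>) b) \<in> borel_measurable M"
      by (rule measurable_from_subalg[OF sub K_b])
    have K_b_int: "integrable M (\<lambda>\<omega>. indicator a \<omega> * measure (K \<omega>) b)"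
      by (intro integrable_const_bound[of _ 1] AE_I2)
        (auto simp: indicator_def K_prob prob_space.prob_le_1)
    have "emeasure (R \<bind> J) Z = (\<integral>\<^sup>+\<omega>. emeasure (J \<omega>) Z \<partial>R)"
      using a b by (intro emeasure_bind[OF R.not_empty J]) (auto simp: Z)
    also have "\<dots> = (\<integral>\<^sup>+\<omega>. ennreal (indicator a \<omega> * measure (K \<omega>) b) \<partial>R)"
    proof (rule nn_integral_cong)
      fix \<omega> assume "\<omega> \<in> space R"
      then have \<omega>: "\<omega> \<in> space M" by (simp add: space_R)
      interpret K: prob_space "K \<omega>" by (rule K_prob(1)[OF \<omega>])
      have "Pair \<omega> -` Z \<inter> space (K \<omega>) = (if \<omega> \<in> a then b else {})"
        using sets.sets_into_space[OF b] by (auto simp: Z K_prob[OF \<omega>])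
      then show "emeasure (J \<omega>) Z = ennreal (indicator a \<omega> * measure (K \<omega>) b)"
        unfolding J_def using a b
        by (simp add: emeasure_distr[OF Pair_K[OF \<omega>]] Z K.emeasure_eq_measure indicator_def)
    qed
    also have "\<dots> = (\<integral>\<^sup>+\<omega>. ennreal (indicator a \<omega> * measure (K \<omega>) b) \<partial>M)"
      unfolding R_def
      by (intro nn_integral_subalgebra2[OF sub] measurable_compose[OF _ measurable_ennreal]
          borel_measurable_times borel_measurable_indicator a K_b)
    also have "\<dots> = ennreal (\<integral>\<omega>. indicator a \<omega> * measure (K \<omega>) b \<partial>M)"
      by (intro nn_integral_eq_integral K_b_int) auto
    also have "(\<integral>\<omega>. indicator a \<omega> * measure (K \<omega>) b \<partial>M)
        = (\<integral>\<omega>. indicator a \<omega> * real_cond_exp M F (\<lambda>\<omega>'. indicator b (X \<omega>')) \<omega> \<partial>M)"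
      using cond[OF b] by (intro integral_cong_AE) auto
    also have "\<dots> = (\<integral>\<omega>. indicator a \<omega> * indicator b (X \<omega>) \<partial>M)"
      using real_cond_exp_intA[OF b_int a] by (simp add: set_lebesgue_integral_def)
    also have "\<dots> = (\<integral>\<omega>. indicator ((\<lambda>\<omega>. (\<omega>, X \<omega>)) -` Z \<inter> space M) \<omega> \<partial>M)"
      by (intro Bochner_Integration.integral_cong) (auto simp: Z indicator_def)
    also have "ennreal \<dots> = emeasure ?D Z"
      using a b by (subst emeasure_distr[OF id])
        (auto simp: Z emeasure_eq_measure Int_commute[of _ "space M"])
    finally show "emeasure ?D Z = emeasure (R \<bind> J) Z" by simp
  qed simp
  have "(\<integral>\<omega>. H \<omega> (X \<omega>) \<partial>M) = (\<integral>z. case_prod H z \<partial>?D)"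
    by (simp add: integral_distr[OF id H])
  also have "\<dots> = (\<integral>\<omega>. (\<integral>z. case_prod H z \<partial>J \<omega>) \<partial>R)"
    unfolding law
  proof (rule integral_bind[where K="F \<Otimes>\<^sub>M N" and B=B and B'=1])
    show "\<And>z. z \<in> space (F \<Otimes>\<^sub>M N) \<Longrightarrow> \<bar>case_prod H z\<bar> \<le> B"
      using bound by (auto simp: space_pair_measure space_F)
    show "AE \<omega> in R. emeasure (J \<omega>) (space (J \<omega>)) \<le> ennreal 1"
      using measurable_space[OF J]
      by (intro AE_I2) (auto simp: space_subprob_algebra dest: subprob_space.emeasure_space_le_1)
  qed (fact H J R.finite_measure_axioms)+
  also have "\<dots> = (\<integral>\<omega>. (\<integral>y. H \<omega> y \<partial>K \<omega>) \<partial>R)"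
    unfolding J_def
    by (intro Bochner_Integration.integral_cong) (simp_all add: integral_distr[OF Pair_K H] space_R)
  also have "\<dots> = (\<integral>\<omega>. (\<integral>y. H \<omega> y \<partial>K \<omega>) \<partial>M)"
    unfolding R_def
    by (rule integral_subalgebra2[OF sub borel_measurable_integral_kernel[OF H K_sub]])
  finally show ?thesis .
qed

section \<open>A strong law for bounded orthogonal sequences\<close>

text \<open>With \<open>m = floor_sqrt n\<close>, the index \<open>n\<close> exceeds
  \<open>m\<^sup>2\<close> by at most \<open>2 * m\<close>. Hence \<open>T\<close> moves by at most
  \<open>2 * m * B\<close> since the last square, and dividing by \<open>m\<^sup>2\<close> leaves an
  error of \<open>2 * B / m\<close>.\<close>

lemma div_tendsto_0_from_squares:
  fixes T :: "nat \<Rightarrow> real"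
  assumes sq: "(\<lambda>m. T (m\<^sup>2) / real (m\<^sup>2)) \<longlonglongrightarrow> 0"
    and step: "\<And>n. \<bar>T (Suc n) - T n\<bar> \<le> B"
  shows "(\<lambda>n. T n / real n) \<longlonglongrightarrow> 0"
proof -
  have B: "0 \<le> B" using step[of 0] by linarith
  have incr: "\<bar>T (n + k) - T n\<bar> \<le> real k * B" for n k
  proof (induction k)
    case (Suc k)
    then show ?case using step[of "n + k"] by (simp add: algebra_simps)
  qed simp
  have lim_sqrt: "filterlim floor_sqrt at_top sequentially"
    unfolding filterlim_at_top
    by (auto simp: eventually_sequentially le_floor_sqrt_iff)
  have "(\<lambda>m. \<bar>T (m\<^sup>2) / real (m\<^sup>2)\<bar> + 2 * B / real m) \<longlonglongrightarrow> 0 + 0"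
    using tendsto_mult_right_zero[OF lim_1_over_n, of "2 * B"]
    by (intro tendsto_add tendsto_rabs_zero sq) simp
  then have lim: "(\<lambda>n. \<bar>T ((floor_sqrt n)\<^sup>2) / real ((floor_sqrt n)\<^sup>2)\<bar> + 2 * B / real (floor_sqrt n))
      \<longlonglongrightarrow> 0"
    using filterlim_compose[of "\<lambda>m. \<bar>T (m\<^sup>2) / real (m\<^sup>2)\<bar> + 2 * B / real m" "nhds 0", OF _ lim_sqrt]
    by simp
  show ?thesis
  proof (rule Lim_null_comparison[OF _ lim])
    show "\<forall>\<^sub>F n in sequentially. norm (T n / real n)
        \<le> \<bar>T ((floor_sqrt n)\<^sup>2) / real ((floor_sqrt n)\<^sup>2)\<bar> + 2 * B / real (floor_sqrt n)"
      using eventually_gt_at_top[of 0]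
    proof eventually_elim
      fix n :: nat assume n: "n > 0"
      define m where "m = floor_sqrt n"
      have m: "m > 0" using n by (simp add: m_def)
      have m_le: "m\<^sup>2 \<le> n" by (simp add: m_def)
      have "n < (Suc m)\<^sup>2" unfolding m_def by (rule Suc_floor_sqrt_power2_gt)
      then have "n - m\<^sup>2 \<le> 2 * m" by (simp add: power2_eq_square)
      then have "real (n - m\<^sup>2) * B \<le> (2 * real m) * B"
        using B by (intro mult_right_mono) linarith+
      moreover have "\<bar>T n - T (m\<^sup>2)\<bar> \<le> real (n - m\<^sup>2) * B"
        using incr[of "m\<^sup>2" "n - m\<^sup>2"] m_le by simp
      ultimately have T: "\<bar>T n\<bar> \<le> \<bar>T (m\<^sup>2)\<bar> + 2 * real m * B" by linarith
      have "\<bar>T n\<bar> / real n \<le> (\<bar>T (m\<^sup>2)\<bar> + 2 * real m * B) / real (m\<^sup>2)"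
        using T m m_le B by (intro frac_le) (auto intro: of_nat_mono simp flip: of_nat_power)
      also have "\<dots> = \<bar>T (m\<^sup>2) / real (m\<^sup>2)\<bar> + 2 * B / real m"
        using m by (simp add: field_simps power2_eq_square)
      finally show "norm (T n / real n)
        \<le> \<bar>T ((floor_sqrt n)\<^sup>2) / real ((floor_sqrt n)\<^sup>2)\<bar> + 2 * B / real (floor_sqrt n)"
        by (simp add: m_def)
    qed
  qed
qed

text \<open>Orthogonality removes the mixed terms, so the normalised sum has second moment at most
  \<open>B\<^sup>2 / n\<close>. This bound is not summable over all \<open>n\<close>, but along
  \<open>n = m\<^sup>2\<close> it is, which is why the argument passes through the squares.\<close>

lemma (in prob_space) strong_law_bounded_orthogonal:
  fixes D :: "nat \<Rightarrow> 'a \<Rightarrow> real"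
  assumes meas[measurable]: "\<And>k. D k \<in> borel_measurable M"
    and bound: "\<And>k \<omega>. \<omega> \<in> space M \<Longrightarrow> \<bar>D k \<omega>\<bar> \<le> B"
    and orth: "\<And>j k. j < k \<Longrightarrow> (\<integral>\<omega>. D j \<omega> * D k \<omega> \<partial>M) = 0"
  shows "AE \<omega> in M. (\<lambda>n. (\<Sum>k<n. D k \<omega>) / real n) \<longlonglongrightarrow> 0"
proof -
  define T where "T n \<omega> = (\<Sum>k<n. D k \<omega>)" for n \<omega>
  have [measurable]: "T n \<in> borel_measurable M" for n unfolding T_def by measurable
  obtain \<omega>\<^sub>0 where "\<omega>\<^sub>0 \<in> space M" using not_empty by auto
  then have B: "0 \<le> B" using bound[of \<omega>\<^sub>0 0] by linarith
  have bound2: "\<bar>D j \<omega> * D k \<omega>\<bar> \<le> B * B" if "\<omega> \<in> space M" for j k \<omega>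
    unfolding abs_mult using bound[OF that] B by (intro mult_mono) auto
  have int_DD: "integrable M (\<lambda>\<omega>. D j \<omega> * D k \<omega>)" for j k
    by (intro integrable_const_bound[of _ "B * B"] AE_I2) (use bound2 in auto)
  have T_sq: "(T n \<omega>)\<^sup>2 = (\<Sum>j<n. \<Sum>k<n. D j \<omega> * D k \<omega>)" for n \<omega>
    by (simp add: T_def power2_eq_square sum_product)
  have int_T: "integrable M (\<lambda>\<omega>. (T n \<omega>)\<^sup>2)" for n
    unfolding T_sq by (intro Bochner_Integration.integrable_sum int_DD)
  have second_moment: "(\<integral>\<omega>. (T n \<omega>)\<^sup>2 \<partial>M) \<le> real n * B\<^sup>2" for n
  proof -
    have "(\<integral>\<omega>. (T n \<omega>)\<^sup>2 \<partial>M) = (\<Sum>j<n. \<Sum>k<n. \<integral>\<omega>. D j \<omega> * D k \<omega> \<partial>M)"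
      unfolding T_sq by (simp add: Bochner_Integration.integral_sum int_DD)
    also have "\<dots> = (\<Sum>j<n. \<Sum>k<n. if k = j then \<integral>\<omega>. D j \<omega> * D j \<omega> \<partial>M else 0)"
    proof (intro sum.cong refl)
      fix j k
      show "(\<integral>\<omega>. D j \<omega> * D k \<omega> \<partial>M) = (if k = j then \<integral>\<omega>. D j \<omega> * D j \<omega> \<partial>M else 0)"
        using orth[of j k] orth[of k j] by (cases j k rule: linorder_cases) (simp_all add: mult.commute)
    qed
    also have "\<dots> = (\<Sum>j<n. \<integral>\<omega>. D j \<omega> * D j \<omega> \<partial>M)" by simp
    also have "\<dots> \<le> (\<Sum>j<n. B\<^sup>2)"
    proof (rule sum_mono)
      fix j
      have "(D j \<omega> * D j \<omega>) \<le> B\<^sup>2" if "\<omega> \<in> space M" for \<omega>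
        using bound2[OF that, of j j] by (simp add: power2_eq_square)
      then show "(\<integral>\<omega>. D j \<omega> * D j \<omega> \<partial>M) \<le> B\<^sup>2"
        by (intro integral_le_const int_DD AE_I2)
    qed
    finally show ?thesis by simp
  qed
  \<comment> \<open>For nonnegative extended reals, sum and integral may be exchanged freely. A
    finite integral then forces the random series to be finite almost everywhere, so its terms tend
    to 0.\<close>
  have "(\<integral>\<^sup>+\<omega>. (\<Sum>m. ennreal ((T (m\<^sup>2) \<omega> / real (m\<^sup>2))\<^sup>2)) \<partial>M)
      = (\<Sum>m. \<integral>\<^sup>+\<omega>. ennreal ((T (m\<^sup>2) \<omega> / real (m\<^sup>2))\<^sup>2) \<partial>M)"
    by (rule nn_integral_suminf) measurable
  also have "\<dots> \<le> (\<Sum>m. ennreal (B\<^sup>2 * inverse (real m ^ 2)))"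
  proof (intro suminf_le summableI)
    fix m :: nat
    have "(\<integral>\<^sup>+\<omega>. ennreal ((T (m\<^sup>2) \<omega> / real (m\<^sup>2))\<^sup>2) \<partial>M)
        = ennreal (\<integral>\<omega>. (T (m\<^sup>2) \<omega> / real (m\<^sup>2))\<^sup>2 \<partial>M)"
      by (intro nn_integral_eq_integral) (simp_all add: power_divide int_T)
    also have "(\<integral>\<omega>. (T (m\<^sup>2) \<omega> / real (m\<^sup>2))\<^sup>2 \<partial>M) = (\<integral>\<omega>. (T (m\<^sup>2) \<omega>)\<^sup>2 \<partial>M) / (real (m\<^sup>2))\<^sup>2"
      by (simp add: power_divide)
    also have "\<dots> \<le> real (m\<^sup>2) * B\<^sup>2 / (real (m\<^sup>2))\<^sup>2"
      by (intro divide_right_mono second_moment) simp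
    \<comment> \<open>At \<open>m = 0\<close> both sides are 0, because division by 0 and
      \<open>inverse 0\<close> yield 0.\<close>
    also have "\<dots> = B\<^sup>2 * inverse (real m ^ 2)"
      by (simp add: power2_eq_square divide_simps)
    finally show "(\<integral>\<^sup>+\<omega>. ennreal ((T (m\<^sup>2) \<omega> / real (m\<^sup>2))\<^sup>2) \<partial>M) \<le> ennreal (B\<^sup>2 * inverse (real m ^ 2))"
      by (simp add: ennreal_leI)
  qed
  also have "\<dots> < top"
  proof -
    have "summable (\<lambda>m. B\<^sup>2 * inverse (real m ^ 2))"
      by (intro summable_mult inverse_power_summable) simp
    then show ?thesis
      unfolding less_top[symmetric] by (rule ennreal_suminf_neq_top) simp
  qed
  finally have "AE \<omega> in M. (\<Sum>m. ennreal ((T (m\<^sup>2) \<omega> / real (m\<^sup>2))\<^sup>2)) \<noteq> \<infinity>"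
    by (intro nn_integral_PInf_AE) auto
  then show ?thesis
    using AE_space
  proof eventually_elim
    fix \<omega> assume fin: "(\<Sum>m. ennreal ((T (m\<^sup>2) \<omega> / real (m\<^sup>2))\<^sup>2)) \<noteq> \<infinity>" and \<omega>: "\<omega> \<in> space M"
    have "summable (\<lambda>m. (T (m\<^sup>2) \<omega> / real (m\<^sup>2))\<^sup>2)"
      by (rule summable_suminf_not_top) (use fin in auto)
    then have "(\<lambda>m. (T (m\<^sup>2) \<omega> / real (m\<^sup>2))\<^sup>2) \<longlonglongrightarrow> 0" by (rule summable_LIMSEQ_zero)
    then have "(\<lambda>m. T (m\<^sup>2) \<omega> / real (m\<^sup>2)) \<longlonglongrightarrow> 0"
      using tendsto_real_sqrt[of "\<lambda>m. (T (m\<^sup>2) \<omega> / real (m\<^sup>2))\<^sup>2" 0]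
      by (simp only: real_sqrt_abs real_sqrt_zero tendsto_rabs_zero_iff)
    then have "(\<lambda>n. T n \<omega> / real n) \<longlonglongrightarrow> 0"
      by (rule div_tendsto_0_from_squares[where B=B]) (simp add: T_def bound[OF \<omega>])
    then show "(\<lambda>n. (\<Sum>k<n. D k \<omega>) / real n) \<longlonglongrightarrow> 0" by (simp add: T_def)
  qed
qed

section \<open>Joint measurability of kernel iterates and bounds for the Poisson solution\<close>

lemma measurable_prob_algebra_of_measure:
  assumes "\<And>z. z \<in> space M \<Longrightarrow> K z \<in> space (prob_algebra N)"
    and "\<And>A. A \<in> sets N \<Longrightarrow> (\<lambda>z. measure (K z) A) \<in> borel_measurable M"
  shows "K \<in> M \<rightarrow>\<^sub>M prob_algebra N"
proof (rule measurable_prob_algebraI)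
  show prob: "prob_space (K z)" if "z \<in> space M" for z
    using assms(1)[OF that] by (simp add: space_prob_algebra)
  show "K \<in> M \<rightarrow>\<^sub>M subprob_algebra N"
  proof (rule measurable_subprob_algebra)
    show "subprob_space (K z)" "sets (K z) = sets N" if "z \<in> space M" for z
      using assms(1)[OF that] by (auto simp: space_prob_algebra intro: prob_space_imp_subprob_space)
    fix A assume "A \<in> sets N"
    then have "(\<lambda>z. ennreal (measure (K z) A)) \<in> borel_measurable M"
      by (intro measurable_compose[OF _ measurable_ennreal] assms)
    then show "(\<lambda>z. emeasure (K z) A) \<in> borel_measurable M"
      by (rule measurable_cong[THEN iffD1, rotated])
        (simp add: finite_measure.emeasure_eq_measure prob_space.finite_measure prob)
  qed
qed

text \<open>The parameter \<open>s\<close> is carried along in the pair \<open>(s, x)\<close>, so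
  that the induction gives measurability jointly in both arguments rather than for each
  \<open>s\<close> separately.\<close>

lemma measurable_kernel_pow:
  assumes P: "(\<lambda>(s, x). P s x) \<in> SS \<Otimes>\<^sub>M XX \<rightarrow>\<^sub>M prob_algebra XX"
  shows "(\<lambda>(s, x). kernel_pow XX (P s) k x) \<in> SS \<Otimes>\<^sub>M XX \<rightarrow>\<^sub>M prob_algebra XX"
proof (induction k)
  case 0
  show ?case
    using measurable_compose[OF measurable_snd measurable_return_prob_space]
    by (simp add: case_prod_beta)
next
  case (Suc k)
  \<comment> \<open>The next transition retains only the parameter \<open>fst z\<close> of the
    starting pair \<open>z\<close>; its new starting point is \<open>y\<close>.\<close>
  have "(\<lambda>(z, y). P (fst z) y) \<in> (SS \<Otimes>\<^sub>M XX) \<Otimes>\<^sub>M XX \<rightarrow>\<^sub>M prob_algebra XX"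
    using measurable_compose[OF _ P, of "\<lambda>w. (fst (fst w), snd w)" "(SS \<Otimes>\<^sub>M XX) \<Otimes>\<^sub>M XX"]
    by (simp add: case_prod_beta)
  from measurable_bind_prob_space2[OF Suc this] show ?case
    by (simp add: case_prod_beta)
qed

lemma abs_integral_le:
  fixes f :: "'a \<Rightarrow> real"
  assumes "prob_space M" "f \<in> borel_measurable M" "\<And>x. x \<in> space M \<Longrightarrow> \<bar>f x\<bar> \<le> B"
  shows "\<bar>\<integral>x. f x \<partial>M\<bar> \<le> B"
proof -
  interpret prob_space M by fact
  have int: "integrable M f"
    using assms by (intro integrable_const_bound[of _ B]) auto
  have "\<bar>\<integral>x. f x \<partial>M\<bar> \<le> (\<integral>x. \<bar>f x\<bar> \<partial>M)" by (rule integral_abs_bound)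
  also have "\<dots> \<le> B"
    using assms int by (intro integral_le_const integrable_abs AE_I2)
  finally show ?thesis .
qed

lemma borel_measurable_poisson_sol:
  assumes P: "(\<lambda>(s, x). P s x) \<in> SS \<Otimes>\<^sub>M XX \<rightarrow>\<^sub>M prob_algebra XX"
    and \<phi>[measurable]: "\<phi> \<in> borel_measurable XX"
  shows "(\<lambda>(s, x). poisson_sol XX \<pi> (P s) \<phi> x) \<in> borel_measurable (SS \<Otimes>\<^sub>M XX)"
proof -
  have "(\<lambda>z. kernel_app (kernel_pow XX (P (fst z)) k) (\<lambda>y. \<phi> y - (\<integral>z. \<phi> z \<partial>\<pi>)) (snd z))
      \<in> borel_measurable (SS \<Otimes>\<^sub>M XX)" for k
  proof -
    have "(\<lambda>z. kernel_pow XX (P (fst z)) k (snd z)) \<in> SS \<Otimes>\<^sub>M XX \<rightarrow>\<^sub>M subprob_algebra XX"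
      using measurable_kernel_pow[OF P, THEN measurable_prob_algebraD] by (simp add: case_prod_beta)
    then show ?thesis
      unfolding kernel_app_def
      by (rule measurable_compose) (rule integral_measurable_subprob_algebra, measurable)
  qed
  then show ?thesis
    unfolding poisson_sol_def case_prod_beta by (rule borel_measurable_suminf)
qed

text \<open>Each iterate has mass 1, so the \<open>k\<close>-th term of the series is the difference
  of the integrals of \<open>\<phi>\<close> under the iterate and under \<open>\<pi>\<close>. The
  total variation bound makes it at most \<open>2 * B * C * \<rho> ^ k\<close>, and a geometric
  series dominates.\<close>

lemma abs_poisson_sol_le:
  assumes \<pi>: "prob_space \<pi>" and sets: "sets \<pi> = sets XX"
    and K: "K \<in> XX \<rightarrow>\<^sub>M prob_algebra XX"
    and \<phi>: "\<phi> \<in> borel_measurable XX"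
    and B: "B > 0" "\<And>x. x \<in> space XX \<Longrightarrow> \<bar>\<phi> x\<bar> \<le> B"
    and \<rho>: "0 \<le> \<rho>" "\<rho> < 1"
    and dtv: "\<And>k. dtv (kernel_pow XX K k x) \<pi> \<le> C * \<rho> ^ k"
    and x: "x \<in> space XX"
  shows "\<bar>poisson_sol XX \<pi> K \<phi> x\<bar> \<le> (\<Sum>k. 2 * B * C * \<rho> ^ k)"
proof -
  have pow: "kernel_pow XX K k \<in> XX \<rightarrow>\<^sub>M prob_algebra XX" for k
  proof (induction k)
    case 0
    have "kernel_pow XX K 0 = return XX" by auto
    then show ?case by (simp add: measurable_return_prob_space)
  next
    case (Suc k)
    have "kernel_pow XX K (Suc k) = (\<lambda>x. kernel_pow XX K k x \<bind> K)" by auto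
    then show ?case using measurable_bind_prob_space[OF Suc K] by simp
  qed
  have "norm (kernel_app (kernel_pow XX K k) (\<lambda>y. \<phi> y - (\<integral>z. \<phi> z \<partial>\<pi>)) x) \<le> 2 * B * C * \<rho> ^ k" for k
  proof -
    define \<mu> where "\<mu> = kernel_pow XX K k x"
    have \<mu>: "prob_space \<mu>" "sets \<mu> = sets XX"
      using measurable_space[OF pow x, of k] by (auto simp: \<mu>_def space_prob_algebra)
    interpret prob_space \<mu> by fact
    have space: "space \<mu> = space XX" using \<mu>(2) by (rule sets_eq_imp_space_eq)
    have \<phi>\<mu>: "\<phi> \<in> borel_measurable \<mu>"
      using \<phi> by (simp add: measurable_cong_sets[OF \<mu>(2) refl])
    have "integrable \<mu> \<phi>"
      using \<phi>\<mu> B(2) by (intro integrable_const_bound[of _ B]) (auto simp: space)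
    then have "kernel_app (kernel_pow XX K k) (\<lambda>y. \<phi> y - (\<integral>z. \<phi> z \<partial>\<pi>)) x
        = (\<integral>y. \<phi> y \<partial>\<mu>) - (\<integral>z. \<phi> z \<partial>\<pi>)"
      by (simp add: kernel_app_def \<mu>_def[symmetric] prob_space)
    also have "\<bar>\<dots>\<bar> \<le> 2 * B * dtv \<mu> \<pi>"
      using B by (intro integral_diff_le_dtv \<mu> \<pi> \<phi>\<mu>) (auto simp: sets \<mu> space)
    also have "\<dots> \<le> 2 * B * (C * \<rho> ^ k)"
      using dtv[of k] B(1) by (intro mult_left_mono) (auto simp: \<mu>_def)
    finally show ?thesis by simp
  qed
  moreover have "summable (\<lambda>k. 2 * B * C * \<rho> ^ k)"
    using \<rho> by (intro summable_mult summable_geometric) simp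
  ultimately show ?thesis
    unfolding poisson_sol_def real_norm_def[symmetric] by (rule norm_suminf_le)
qed

section \<open>Application to the remainder and martingale parts\<close>

text \<open>Serves both normalisations of the remainder, \<open>real n\<close> and
  \<open>sqrt (real n)\<close>.\<close>

lemma tendsto_bounded_div_0:
  fixes r :: "nat \<Rightarrow> real"
  assumes "\<And>n. \<bar>r n\<bar> \<le> B" and "filterlim a at_top sequentially"
  shows "(\<lambda>n. r n / a n) \<longlonglongrightarrow> 0"
proof (rule Lim_null_comparison)
  show "\<forall>\<^sub>F n in sequentially. norm (r n / a n) \<le> B / a n"
    using filterlim_at_top_dense[THEN iffD1, OF assms(2), rule_format, of 0]
    by eventually_elim (use assms(1) in \<open>simp add: abs_divide divide_right_mono\<close>)
  show "(\<lambda>n. B / a n) \<longlonglongrightarrow> 0"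
    by (rule tendsto_divide_0[OF tendsto_const filterlim_at_top_imp_at_infinity[OF assms(2)]])
qed

lemma (in filtration) measurable_F_mono:
  assumes "f \<in> F i \<rightarrow>\<^sub>M N" "i \<le> j"
  shows "f \<in> F j \<rightarrow>\<^sub>M N"
  by (rule measurable_from_subalg[OF _ assms(1)])
    (use sets_F_mono[OF assms(2)] in \<open>simp add: subalgebra_def space_F\<close>)

theorem lemma5:
  fixes XX :: "'x measure" and SS :: "'s measure" and \<pi> :: "'x measure"
    and P :: "'s \<Rightarrow> 'x \<Rightarrow> 'x measure"
    and M :: "'w measure" and F :: "nat \<Rightarrow> 'w measure"
    and S :: "nat \<Rightarrow> 'w \<Rightarrow> 's" and X :: "nat \<Rightarrow> 'w \<Rightarrow> 'x"
    and \<phi> :: "'x \<Rightarrow> real" and g :: "'s \<Rightarrow> 'x \<Rightarrow> real"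
  assumes "prob_space \<pi>" and "sets \<pi> = sets XX"
    and "\<And>s. s \<in> space SS \<Longrightarrow> P s \<in> XX \<rightarrow>\<^sub>M prob_algebra XX"
    and "\<And>s. s \<in> space SS \<Longrightarrow> \<pi> \<bind> P s = \<pi>"
    and "\<And>A. A \<in> sets XX \<Longrightarrow> (\<lambda>(s, x). measure (P s x) A) \<in> borel_measurable (SS \<Otimes>\<^sub>M XX)"
    and "prob_space M" and "filtration (space M) F" and "\<And>k. subalgebra M (F k)"
    and "\<And>k. S k \<in> F k \<rightarrow>\<^sub>M SS" and "\<And>k. X k \<in> F k \<rightarrow>\<^sub>M XX"
    and "\<And>k A. A \<in> sets XX \<Longrightarrow>
           AE \<omega> in M. real_cond_exp M (F k) (\<lambda>\<omega>'. indicator A (X (Suc k) \<omega>')) \<omega>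
                        = measure (P (S k \<omega>) (X k \<omega>)) A"
    and "\<phi> \<in> borel_measurable XX" and "bounded (\<phi> ` space XX)"
    and "\<exists>C \<rho> :: real. 0 \<le> \<rho> \<and> \<rho> < 1 \<and>
           (\<forall>x\<in>space XX. \<forall>s\<in>space SS. \<forall>k. dtv (kernel_pow XX (P s) k x) \<pi> \<le> C * \<rho> ^ k)"
    and "\<And>s x. g s x = poisson_sol XX \<pi> (P s) \<phi> x"
  shows "AE \<omega> in M.
           (\<lambda>n. R_part P g S X n \<omega> / real n) \<longlonglongrightarrow> 0 \<and>
           (\<lambda>n. R_part P g S X n \<omega> / sqrt (real n)) \<longlonglongrightarrow> 0 \<and>
           (\<lambda>n. M_part P g S X n \<omega> / real n) \<longlonglongrightarrow> 0"
proof -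
  note \<pi> = assms(1,2) and P = assms(3) and P_meas = assms(5) and sub = assms(8)
    and S = assms(9) and X = assms(10) and cond = assms(11) and g_def = assms(15)
  interpret prob_space M by fact
  interpret filtration "space M" F by fact
  \<comment> \<open>That the values are probability measures on \<open>XX\<close> comes from each
    \<open>P s\<close> separately; joint measurability comes from the setwise assumption.\<close>
  have P_joint: "(\<lambda>(s, x). P s x) \<in> SS \<Otimes>\<^sub>M XX \<rightarrow>\<^sub>M prob_algebra XX"
    using measurable_space[OF P] P_meas
    by (intro measurable_prob_algebra_of_measure) (auto simp: space_pair_measure case_prod_beta)
  have "g = (\<lambda>s x. poisson_sol XX \<pi> (P s) \<phi> x)" by (intro ext g_def)
  then have g_meas: "case_prod g \<in> borel_measurable (SS \<Otimes>\<^sub>M XX)"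
    using borel_measurable_poisson_sol[OF P_joint assms(12)] by simp
  \<comment> \<open>A strictly positive bound is chosen because the rescaling to the unit interval
    divides by \<open>2 * B\<close>.\<close>
  obtain B where B: "B > 0" "\<And>x. x \<in> space XX \<Longrightarrow> \<bar>\<phi> x\<bar> \<le> B"
    using assms(13) by (auto simp: bounded_pos)
  obtain C \<rho> where \<rho>: "0 \<le> \<rho>" "\<rho> < 1"
    and dtv: "\<And>x s k. x \<in> space XX \<Longrightarrow> s \<in> space SS \<Longrightarrow> dtv (kernel_pow XX (P s) k x) \<pi> \<le> C * \<rho> ^ k"
    using assms(14) by blast
  define G where "G = (\<Sum>k. 2 * B * C * \<rho> ^ k)"
  have g_bound: "\<bar>g s x\<bar> \<le> G" if "s \<in> space SS" "x \<in> space XX" for s x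
    unfolding G_def g_def
    by (intro abs_poisson_sol_le \<pi> P assms(12) B \<rho> dtv that)
  have S_in: "S k \<omega> \<in> space SS" and X_in: "X k \<omega> \<in> space XX" if "\<omega> \<in> space M" for k \<omega>
    using measurable_space[OF S, of \<omega> k] measurable_space[OF X, of \<omega> k] that by (simp_all add: space_F)
  \<comment> \<open>This quantity plays two roles: it is the compensator in the martingale part and
    the telescoping term in the remainder.\<close>
  define Pg where "Pg k \<omega> = kernel_app (P (S k \<omega>)) (g (S k \<omega>)) (X k \<omega>)" for k \<omega>
  have Pg_bound: "\<bar>Pg k \<omega>\<bar> \<le> G" if "\<omega> \<in> space M" for k \<omega>
    unfolding Pg_def kernel_app_def
  proof (rule abs_integral_le)
    have K: "P (S k \<omega>) (X k \<omega>) \<in> space (prob_algebra XX)"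
      by (rule measurable_space[OF P[OF S_in[OF that]] X_in[OF that]])
    then show "prob_space (P (S k \<omega>) (X k \<omega>))" by (simp add: space_prob_algebra)
    from K have sets: "sets (P (S k \<omega>) (X k \<omega>)) = sets XX" by (simp add: space_prob_algebra)
    have "g (S k \<omega>) \<in> borel_measurable XX"
      using measurable_compose[OF measurable_Pair1'[OF S_in[OF that]] g_meas] by simp
    then show "g (S k \<omega>) \<in> borel_measurable (P (S k \<omega>) (X k \<omega>))"
      by (simp add: measurable_cong_sets[OF sets refl])
    show "\<bar>g (S k \<omega>) y\<bar> \<le> G" if "y \<in> space (P (S k \<omega>) (X k \<omega>))" for y
      using that sets_eq_imp_space_eq[OF sets] by (intro g_bound S_in \<open>\<omega> \<in> space M\<close>) simp
  qed
  have K: "(\<lambda>\<omega>. P (S k \<omega>) (X k \<omega>)) \<in> F k \<rightarrow>\<^sub>M prob_algebra XX" for k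
    using measurable_compose[OF measurable_Pair[OF S X] P_joint] by simp
  have gS: "(\<lambda>(\<omega>, y). g (S k \<omega>) y) \<in> borel_measurable (F k \<Otimes>\<^sub>M XX)" for k
    using measurable_compose[OF measurable_Pair[OF measurable_compose[OF measurable_fst S] measurable_snd] g_meas]
    by (simp add: case_prod_beta)
  have Pg_meas: "Pg k \<in> borel_measurable (F k)" for k
    using borel_measurable_integral_kernel[OF gS K[THEN measurable_prob_algebraD]]
    by (simp add: Pg_def[abs_def] kernel_app_def)
  \<comment> \<open>Indices are shifted by one: \<open>D k\<close> is the summand of
    \<open>M_part\<close> with index \<open>Suc k\<close>, hence measurable at time
    \<open>Suc k\<close>.\<close>
  define D where "D k \<omega> = g (S k \<omega>) (X (Suc k) \<omega>) - Pg k \<omega>" for k \<omega>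
  have D_meas_F: "D k \<in> borel_measurable (F (Suc k))" for k
  proof -
    have "(\<lambda>\<omega>. case_prod g (S k \<omega>, X (Suc k) \<omega>)) \<in> borel_measurable (F (Suc k))"
      by (intro measurable_compose[OF _ g_meas] measurable_Pair X measurable_F_mono[OF S]) simp
    then show ?thesis
      unfolding D_def[abs_def] using measurable_F_mono[OF Pg_meas, of k "Suc k"] by simp
  qed
  have D_meas: "D k \<in> borel_measurable M" for k
    by (rule measurable_from_subalg[OF sub D_meas_F])
  have D_bound: "\<bar>D k \<omega>\<bar> \<le> 2 * G" if "\<omega> \<in> space M" for k \<omega>
    using g_bound[OF S_in X_in, OF that that, of k "Suc k"] Pg_bound[OF that, of k]
    unfolding D_def by linarith
  have G: "0 \<le> G"
  proof -
    obtain \<omega> where "\<omega> \<in> space M" using not_empty by auto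
    from Pg_bound[OF this, of 0] show ?thesis by linarith
  qed
  have orth: "(\<integral>\<omega>. D j \<omega> * D k \<omega> \<partial>M) = 0" if "j < k" for j k
  proof -
    have Dj: "D j \<in> borel_measurable (F k)"
      by (rule measurable_F_mono[OF D_meas_F]) (use that in simp)
    have X': "X (Suc k) \<in> M \<rightarrow>\<^sub>M XX" by (rule measurable_from_subalg[OF sub X])
    have bound: "\<bar>D j \<omega> * g (S k \<omega>) y\<bar> \<le> 2 * G * G" if "\<omega> \<in> space M" "y \<in> space XX" for \<omega> y
      unfolding abs_mult using that G by (intro mult_mono D_bound g_bound S_in) auto
    have meas: "(\<lambda>(\<omega>, y). D j \<omega> * g (S k \<omega>) y) \<in> borel_measurable (F k \<Otimes>\<^sub>M XX)"
      using borel_measurable_times[OF measurable_compose[OF measurable_fst Dj] gS]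
      by (simp add: case_prod_beta)
    have "(\<integral>\<omega>. D j \<omega> * g (S k \<omega>) (X (Suc k) \<omega>) \<partial>M)
        = (\<integral>\<omega>. (\<integral>y. D j \<omega> * g (S k \<omega>) y \<partial>P (S k \<omega>) (X k \<omega>)) \<partial>M)"
      by (rule integral_cond_kernel[OF sub X' K cond meas bound])
    also have "\<dots> = (\<integral>\<omega>. D j \<omega> * Pg k \<omega> \<partial>M)"
      by (simp add: Pg_def kernel_app_def)
    finally have eq: "(\<integral>\<omega>. D j \<omega> * g (S k \<omega>) (X (Suc k) \<omega>) \<partial>M) = (\<integral>\<omega>. D j \<omega> * Pg k \<omega> \<partial>M)" .
    have Pg_M: "Pg k \<in> borel_measurable M" by (rule measurable_from_subalg[OF sub Pg_meas])
    have "(\<lambda>\<omega>. D k \<omega> + Pg k \<omega>) \<in> borel_measurable M"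
      by (intro borel_measurable_add D_meas Pg_M)
    then have g_M: "(\<lambda>\<omega>. g (S k \<omega>) (X (Suc k) \<omega>)) \<in> borel_measurable M" by (simp add: D_def)
    have int1: "integrable M (\<lambda>\<omega>. D j \<omega> * g (S k \<omega>) (X (Suc k) \<omega>))"
      using bound X_in by (intro integrable_const_bound[of _ "2 * G * G"] borel_measurable_times D_meas g_M AE_I2) simp
    have int2: "integrable M (\<lambda>\<omega>. D j \<omega> * Pg k \<omega>)"
    proof (intro integrable_const_bound[of _ "2 * G * G"] borel_measurable_times D_meas Pg_M AE_I2)
      show "norm (D j \<omega> * Pg k \<omega>) \<le> 2 * G * G" if "\<omega> \<in> space M" for \<omega>
        unfolding real_norm_def abs_mult using that G by (intro mult_mono D_bound Pg_bound) auto
    qed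
    \<comment> \<open>Only the later factor \<open>D k\<close> is expanded; its two contributions
      cancel by \<open>eq\<close>, with \<open>D j\<close> acting as a known multiplier.\<close>
    have "(\<integral>\<omega>. D j \<omega> * D k \<omega> \<partial>M)
        = (\<integral>\<omega>. D j \<omega> * g (S k \<omega>) (X (Suc k) \<omega>) - D j \<omega> * Pg k \<omega> \<partial>M)"
      by (simp add: D_def[of k] right_diff_distrib)
    also have "\<dots> = 0" using int1 int2 eq by simp
    finally show ?thesis .
  qed
  have M_eq: "M_part P g S X n \<omega> = (\<Sum>k<n. D k \<omega>)" for n \<omega>
    by (simp add: M_part_def D_def Pg_def sum.atLeast1_atMost_eq)
  have R_eq: "R_part P g S X n \<omega> = Pg 0 \<omega> - Pg n \<omega>" for n \<omega>
    using sum_lessThan_telescope'[of "\<lambda>k. Pg k \<omega>" n]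
    by (simp add: R_part_def Pg_def sum.atLeast1_atMost_eq)
  have "AE \<omega> in M. (\<lambda>n. M_part P g S X n \<omega> / real n) \<longlonglongrightarrow> 0"
    unfolding M_eq by (rule strong_law_bounded_orthogonal[OF D_meas D_bound orth])
  then show ?thesis
    using AE_space
  proof eventually_elim
    fix \<omega> assume M: "(\<lambda>n. M_part P g S X n \<omega> / real n) \<longlonglongrightarrow> 0" and \<omega>: "\<omega> \<in> space M"
    have R: "\<bar>R_part P g S X n \<omega>\<bar> \<le> 2 * G" for n
      using Pg_bound[OF \<omega>, of 0] Pg_bound[OF \<omega>, of n] unfolding R_eq by linarith
    show "(\<lambda>n. R_part P g S X n \<omega> / real n) \<longlonglongrightarrow> 0 \<and>
      (\<lambda>n. R_part P g S X n \<omega> / sqrt (real n)) \<longlonglongrightarrow> 0 \<and>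
      (\<lambda>n. M_part P g S X n \<omega> / real n) \<longlonglongrightarrow> 0"
      by (intro conjI M tendsto_bounded_div_0[OF R] filterlim_real_sequentially
          filterlim_compose[OF sqrt_at_top])
  qed
qed

end
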